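(* Let $n\geq 1$, let $B,J$ be finite sets and $f:B^J\to\{0,1\}^{I_n}$ with $f(B^J)=\mathsf{Mon}_n$. For all $i,j\in I_n$ and $v\in\{0,1\}$, there exists a partial input $\alpha$ with $$\mathrm{dom}(\alpha)=\Uparrow[\![i+1,j]\!]\ \cup\ \Uparrow[\![j,i]\!]$$ such that $f(x)_j=v$ for every $x\in B^J$ extending $\alpha$.
   Context: For a function $f:B^J\to A^I$ with $B,J,A,I$ finite, the input window $\mathcal{W}_f(i)\subseteq J$ of $i\in I$ is the smallest $W\subseteq J$ such that for all $x,y\in B^J$ agreeing on $W$, $f(x)_i=f(y)_i$. For $S\subseteq I$, $\Uparrow S=\bigcap_{i\in S}\mathcal{W}_f(i)$. A partial input is a function $\alpha:D\to B$ for some $D\subseteq J$ (its domain $\mathrm{dom}(\alpha)$); $x\in B^J$ extends $\alpha$ if $x$ agrees with $\alpha$ on $D$. $\mathsf{Mon}_n\subseteq\{0,1\}^n$ is the set of binary strings $x_0\ldots x_{n-1}$ that are non-decreasing or non-increasing. Positions $I_n=\{0,\ldots,n-1\}$ are identified with $\mathbb{Z}/n\mathbb{Z}$. For $a,b\in\mathbb{Z}$, the interval $[\![a,b]\!]=\{c\bmod n: c\in\mathbb{Z},\ a\leq c\leq b'\}$ where $b'$ is the representative of $b$ modulo $n$ with $a\leq b'<a+n$ (it depends only on $a,b$ modulo $n$). *)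

theory Defs
  imports Main "HOL-Library.FuncSet" "HOL-Number_Theory.Cong"
begin

text \<open>
  Inputs are the elements of \<open>J \<rightarrow>\<^sub>E B\<close>; positions are the naturals below \<open>n\<close>, so that
  outputs are the elements of \<open>{..<n} \<rightarrow>\<^sub>E {0, 1}\<close>.
\<close>

definition input_window :: "'b set \<Rightarrow> 'j set \<Rightarrow> (('j \<Rightarrow> 'b) \<Rightarrow> 'i \<Rightarrow> 'a) \<Rightarrow> 'i \<Rightarrow> 'j set" where
  "input_window B J f i =
     (LEAST W. W \<subseteq> J \<and>
        (\<forall>x \<in> J \<rightarrow>\<^sub>E B. \<forall>y \<in> J \<rightarrow>\<^sub>E B. (\<forall>k\<in>W. x k = y k) \<longrightarrow> f x i = f y i))"

text \<open>
  The order used by \<open>LEAST\<close> is set inclusion. It is meaningful because, for finite \<open>J\<close>, a least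
  such set exists:
\<close>

lemma input_window_least:
  fixes B :: "'b set" and J :: "'j set" and f :: "('j \<Rightarrow> 'b) \<Rightarrow> 'i \<Rightarrow> 'a"
  assumes "finite J"
  defines "P \<equiv> \<lambda>i W. W \<subseteq> J \<and>
        (\<forall>x \<in> J \<rightarrow>\<^sub>E B. \<forall>y \<in> J \<rightarrow>\<^sub>E B. (\<forall>k\<in>W. x k = y k) \<longrightarrow> f x i = f y i)"
  shows "P i (input_window B J f i)"
    and "P i W \<Longrightarrow> input_window B J f i \<subseteq> W"
proof -
  have inter: "P i (V \<inter> W)" if V: "P i V" and W: "P i W" for V W
    unfolding P_def
  proof (intro conjI ballI impI)
    show "V \<inter> W \<subseteq> J" using V by (auto simp: P_def)
  next
    fix x y assume x: "x \<in> J \<rightarrow>\<^sub>E B" and y: "y \<in> J \<rightarrow>\<^sub>E B" and eq: "\<forall>k\<in>V \<inter> W. x k = y k"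
    define z where "z = (\<lambda>k. if k \<in> V then x k else y k)"
    have z: "z \<in> J \<rightarrow>\<^sub>E B"
    proof (rule PiE_I)
      show "z k \<in> B" if "k \<in> J" for k
        using PiE_mem[OF x that] PiE_mem[OF y that] by (simp add: z_def)
      show "z k = undefined" if "k \<notin> J" for k
        using PiE_arb[OF x that] PiE_arb[OF y that] by (simp add: z_def)
    qed
    have "\<forall>k\<in>V. x k = z k" by (simp add: z_def)
    then have "f x i = f z i" using V x z unfolding P_def by blast
    moreover have "\<forall>k\<in>W. z k = y k" using eq by (simp add: z_def)
    then have "f z i = f y i" using W y z unfolding P_def by blast
    ultimately show "f x i = f y i" by simp
  qed
  have "P i J"
    unfolding P_def
  proof (intro conjI ballI impI order_refl)
    fix x y assume "x \<in> J \<rightarrow>\<^sub>E B" "y \<in> J \<rightarrow>\<^sub>E B" "\<forall>k\<in>J. x k = y k"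
    then have "x = y" by (intro PiE_ext) auto
    then show "f x i = f y i" by simp
  qed
  then obtain W0 where W0: "P i W0" and min: "\<And>W. P i W \<Longrightarrow> card W0 \<le> card W"
    using ex_has_least_nat[of "P i" J card] by metis
  have least: "W0 \<subseteq> W" if "P i W" for W
  proof -
    have "finite W0" using W0 assms(1) finite_subset by (auto simp: P_def)
    moreover have "card W0 \<le> card (W0 \<inter> W)" by (rule min[OF inter[OF W0 that]])
    ultimately have "W0 \<inter> W = W0" by (intro card_seteq) auto
    then show ?thesis by blast
  qed
  have "input_window B J f i = (LEAST W. P i W)"
    by (simp add: input_window_def P_def)
  also have "\<dots> = W0" by (rule Least_equality) (fact W0, rule least)
  finally have *: "input_window B J f i = W0" .
  show "P i (input_window B J f i)" using W0 * by simp
  show "P i W \<Longrightarrow> input_window B J f i \<subseteq> W" using least * by simp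
qed

text \<open>
  The intersection of input windows is taken inside \<open>J\<close>, so it is \<open>J\<close> when \<open>S\<close> is empty.
\<close>

definition common_window :: "'b set \<Rightarrow> 'j set \<Rightarrow> (('j \<Rightarrow> 'b) \<Rightarrow> 'i \<Rightarrow> 'a) \<Rightarrow> 'i set \<Rightarrow> 'j set" where
  "common_window B J f S = J \<inter> (\<Inter>i\<in>S. input_window B J f i)"

definition partial_input :: "'b set \<Rightarrow> 'j set \<Rightarrow> ('j \<rightharpoonup> 'b) \<Rightarrow> bool" where
  "partial_input B J \<alpha> \<longleftrightarrow> dom \<alpha> \<subseteq> J \<and> ran \<alpha> \<subseteq> B"

definition extends_input :: "('j \<Rightarrow> 'b) \<Rightarrow> ('j \<rightharpoonup> 'b) \<Rightarrow> bool" where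
  "extends_input x \<alpha> \<longleftrightarrow> (\<forall>k \<in> dom \<alpha>. \<alpha> k = Some (x k))"

definition Mon :: "nat \<Rightarrow> (nat \<Rightarrow> nat) set" where
  "Mon n = {x \<in> {..<n} \<rightarrow>\<^sub>E {0, 1}. mono_on {..<n} x \<or> antimono_on {..<n} x}"

text \<open>
  Cyclic intervals of residues modulo \<open>n\<close>; \<open>b'\<close> is the representative of \<open>b\<close> with
  \<open>a \<le> b' < a + n\<close>. For \<open>n \<ge> 1\<close> these are never empty; the interval from \<open>i + 1\<close> to \<open>i\<close>
  consists of all positions.
\<close>

definition cyc_interval :: "nat \<Rightarrow> int \<Rightarrow> int \<Rightarrow> nat set" where
  "cyc_interval n a b =
     {nat (c mod int n) | c b'. [b' = b] (mod int n) \<and> a \<le> b' \<and> b' < a + int n \<and> a \<le> c \<and> c \<le> b'}"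

end

theory Submission imports Defs begin

text \<open>
  Identifying \<open>0\<close> at a position with \<open>1\<close> one turn later, cut the circle of positions between
  \<open>i\<close> and \<open>i + 1\<close>, so that the two intervals become the positions up to \<open>j\<close> and from \<open>j\<close>
  on. Monotone words stay monotone, that is, two equal letters enclose only that letter.
  Let \<open>\<alpha>\<close> be the restriction of an input whose word is constant after the cut, with letter \<open>v\<close>
  at \<open>j\<close>. Every input position outside the domain is ignored by an output \<open>a \<le> j\<close> and by an
  output \<open>b \<ge> j\<close>. If modifying a set of such positions changed the letter at \<open>j\<close>, then for a
  minimal such set all the outputs \<open>a\<close>, or all the outputs \<open>b\<close>, would carry the wrong letter.
  Undoing the modifications one by one, starting with the one whose ignoring output is closest
  to \<open>j\<close>, preserves this property; hence the constant initial word has a wrong letter.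
\<close>

section \<open>Undoing modifications at ignored positions\<close>

text \<open>Drop from \<open>T\<close> the \<open>k\<close> of largest rank: the letter at
  \<open>p k\<close> ignores this and stays false, and \<open>closed\<close>, applied to the proper
  subset \<open>T - {k}\<close>, passes falsity on to the remaining letters. Repeating this empties
  \<open>T\<close>.\<close>

lemma ignored_letters_stay_false:
  fixes Q :: "'k set \<Rightarrow> 'p \<Rightarrow> bool" and p :: "'k \<Rightarrow> 'p" and rank :: "'p \<Rightarrow> int"
  assumes "finite T" and "T \<noteq> {}" and "T \<subseteq> S"
    and "\<And>k. k \<in> T \<Longrightarrow> \<not> Q T (p k)"
    and ignore: "\<And>T k. T \<subseteq> S \<Longrightarrow> k \<in> T \<Longrightarrow> Q (T - {k}) (p k) = Q T (p k)"
    and closed: "\<And>T k l. T \<subset> S \<Longrightarrow> k \<in> S \<Longrightarrow> l \<in> S \<Longrightarrow> rank (p l) \<le> rank (p k) \<Longrightarrow>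
        \<not> Q T (p k) \<Longrightarrow> \<not> Q T (p l)"
  shows "\<exists>k\<in>S. \<not> Q {} (p k)"
  using assms(1-4)
proof (induction T rule: finite_psubset_induct)
  case (psubset T)
  have "Max ((rank \<circ> p) ` T) \<in> (rank \<circ> p) ` T"
    using psubset.hyps psubset.prems(1) by (intro Max_in) auto
  then obtain k where k: "k \<in> T" and k_max: "rank (p k) = Max ((rank \<circ> p) ` T)"
    by auto
  have max: "rank (p l) \<le> rank (p k)" if "l \<in> T" for l
    using that psubset.hyps unfolding k_max by (intro Max_ge) auto
  have kF: "\<not> Q (T - {k}) (p k)"
    using ignore[OF psubset.prems(2) k] psubset.prems(3)[OF k] by simp
  show ?case
  proof (cases "T - {k} = {}")
    case True
    with kF have "\<not> Q {} (p k)" by simp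
    then show ?thesis using k psubset.prems(2) by blast
  next
    case False
    have "\<not> Q (T - {k}) (p l)" if "l \<in> T - {k}" for l
      using closed[of "T - {k}" k l] kF k max[of l] that psubset.prems(2) by auto
    then show ?thesis using psubset.IH[of "T - {k}"] False k psubset.prems(2) by blast
  qed
qed

text \<open>\<open>Q S s\<close> stands for the letter at \<open>s\<close> after modifying the input
  positions in \<open>S\<close>. By induction all proper subsets of \<open>S\<close> keep the letter
  at \<open>j\<close> true, so a failure at \<open>S\<close> is a minimal one.\<close>

lemma letter_unchanged:
  fixes Q :: "'k set \<Rightarrow> nat \<Rightarrow> bool" and a b :: "'k \<Rightarrow> nat"
  assumes "finite E"
    and between: "\<And>S r s t. S \<subseteq> E \<Longrightarrow> r \<le> s \<Longrightarrow> s \<le> t \<Longrightarrow> t < n \<Longrightarrow> Q S r = Q S t \<Longrightarrow>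
        Q S s = Q S r"
    and pos: "\<And>k. k \<in> E \<Longrightarrow> a k \<le> j \<and> j \<le> b k \<and> b k < n"
    and ignore_a: "\<And>S k. S \<subseteq> E \<Longrightarrow> k \<in> S \<Longrightarrow> Q (S - {k}) (a k) = Q S (a k)"
    and ignore_b: "\<And>S k. S \<subseteq> E \<Longrightarrow> k \<in> S \<Longrightarrow> Q (S - {k}) (b k) = Q S (b k)"
    and start: "\<And>s. s < n \<Longrightarrow> Q {} s"
    and "j < n" and "S \<subseteq> E"
  shows "Q S j"
  using finite_subset[OF \<open>S \<subseteq> E\<close> \<open>finite E\<close>] \<open>S \<subseteq> E\<close>
proof (induction S rule: finite_psubset_induct)
  case (psubset S)
  note S = \<open>S \<subseteq> E\<close>
  have sub: "Q T j" if "T \<subset> S" for T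
    using psubset.IH[OF that] that S by blast
  show ?case
  proof (rule ccontr)
    assume nj: "\<not> Q S j"
    then have ne: "S \<noteq> {}" using start \<open>j < n\<close> by auto
    have opp: "Q S (a k) \<noteq> Q S (b k)" if "k \<in> S" for k
    proof
      let ?R = "S - {k}"
      assume eq: "Q S (a k) = Q S (b k)"
      have k: "a k \<le> j" "j \<le> b k" "b k < n" using pos that S by auto
      have "Q S j = Q S (a k)" by (rule between[OF S k eq])
      moreover have eqR: "Q ?R (a k) = Q S (a k)" "Q ?R (b k) = Q S (b k)"
        using ignore_a[OF S that] ignore_b[OF S that] .
      moreover have "Q ?R j = Q ?R (a k)"
        by (rule between[OF _ k]) (use S eq eqR in auto)
      moreover have "Q ?R j" using that by (intro sub) auto
      ultimately show False using nj by simp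
    qed
    \<comment> \<open>True letters at some \<open>a k\<close> and some \<open>b l\<close> would
      enclose \<open>j\<close> and make it true, so one side is entirely false.\<close>
    consider (left) "\<And>k. k \<in> S \<Longrightarrow> \<not> Q S (a k)" | (right) "\<And>k. k \<in> S \<Longrightarrow> \<not> Q S (b k)"
    proof (cases "\<exists>k\<in>S. Q S (a k)")
      case True
      then obtain k where k: "k \<in> S" "Q S (a k)" by blast
      have "\<not> Q S (b l)" if "l \<in> S" for l
        using between[OF S, of "a k" j "b l"] pos[of k] pos[of l] k that S nj by auto
      then show ?thesis using that by blast
    qed (use that in blast)
    then show False
    proof cases
      case left
      \<comment> \<open>For \<open>closed\<close>: the letter at \<open>j\<close> is true for proper
        subsets, so a true letter at \<open>a l\<close> would make all letters from
        \<open>a l\<close> to \<open>j\<close> true, including the one at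
        \<open>a k\<close>.\<close>
      have "\<exists>k\<in>S. \<not> Q {} (a k)"
      proof (rule ignored_letters_stay_false[where rank = int and T = S])
        fix T k l
        assume T: "T \<subset> S" and k: "k \<in> S" and le: "int (a l) \<le> int (a k)" and F: "\<not> Q T (a k)"
        then show "\<not> Q T (a l)"
          using between[of T "a l" "a k" j] pos[of k] S sub[OF T] \<open>j < n\<close> by auto
      next
        show "Q (T - {k}) (a k) = Q T (a k)" if "T \<subseteq> S" "k \<in> T" for T k
          using ignore_a[of T k] that S by blast
      qed (use psubset.hyps ne left in auto)
      then show False using start pos S \<open>j < n\<close> by (meson le_less_trans subsetD)
    next
      case right
      \<comment> \<open>Right of \<open>j\<close> the closest position is the smallest one, hence
        the negated rank.\<close>
      have "\<exists>k\<in>S. \<not> Q {} (b k)"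
      proof (rule ignored_letters_stay_false[where rank = "\<lambda>s. - int s" and T = S])
        fix T k l
        assume T: "T \<subset> S" and k: "k \<in> S" and l: "l \<in> S"
          and le: "- int (b l) \<le> - int (b k)" and F: "\<not> Q T (b k)"
        then show "\<not> Q T (b l)"
          using between[of T j "b k" "b l"] pos[of k] pos[of l] S sub[OF T] by auto
      next
        show "Q (T - {k}) (b k) = Q T (b k)" if "T \<subseteq> S" "k \<in> T" for T k
          using ignore_b[of T k] that S by blast
      qed (use psubset.hyps ne right in auto)
      then show False using start pos S by blast
    qed
  qed
qed

section \<open>Cyclic intervals counted from the cut\<close>

lemma cong_int_window_unique:
  fixes x y c m :: int
  assumes "[x = y] (mod m)" "c \<le> x" "x < c + m" "c \<le> y" "y < c + m"
  shows "x = y"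
proof -
  have "[x - c = y - c] (mod m)" using assms(1) by (intro cong_diff) auto
  then show ?thesis using cong_less_imp_eq_int[of "x - c" m "y - c"] assms by auto
qed

text \<open>The residue of \<open>j - i - 1\<close> modulo \<open>n\<close>, split into cases to
  avoid truncated subtraction. For \<open>j = i\<close> it is \<open>n - 1\<close>: the full
  turn.\<close>

definition offset :: "nat \<Rightarrow> nat \<Rightarrow> nat \<Rightarrow> nat" where
  "offset n i j = (if i < j then j - i - 1 else n + j - i - 1)"

lemma offset_less: "i < n \<Longrightarrow> j < n \<Longrightarrow> offset n i j < n"
  by (auto simp: offset_def)

lemma offset_mod: "i < n \<Longrightarrow> j < n \<Longrightarrow> (i + 1 + offset n i j) mod n = j"
  by (auto simp: offset_def)

lemma cyc_interval_left:
  assumes "i < n" "j < n" "p \<in> cyc_interval n (int i + 1) (int j)"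
  shows "\<exists>s \<le> offset n i j. p = (i + 1 + s) mod n"
proof -
  obtain c b' where p: "p = nat (c mod int n)" and b': "[b' = int j] (mod int n)"
    "int i + 1 \<le> b'" "b' < int i + 1 + int n" and c: "int i + 1 \<le> c" "c \<le> b'"
    using assms(3) by (auto simp: cyc_interval_def)
  have "[i + 1 + offset n i j = j] (mod n)"
    using offset_mod[OF assms(1,2)] assms(2) by (simp add: cong_def)
  then have "[int (i + 1 + offset n i j) = int j] (mod int n)"
    by (subst cong_int_iff)
  then have "b' = int (i + 1 + offset n i j)"
    using b' offset_less[OF assms(1,2)]
    by (intro cong_int_window_unique[of _ _ "int n" "int i + 1"]) (auto intro: cong_trans cong_sym)
  moreover have "c = int (i + 1 + nat (c - int i - 1))" using c by simp
  then have "p = (i + 1 + nat (c - int i - 1)) mod n"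
    using p by (metis nat_int of_nat_mod)
  ultimately show ?thesis using c by (intro exI[of _ "nat (c - int i - 1)"]) auto
qed

lemma cyc_interval_right:
  assumes "i < n" "j < n" "p \<in> cyc_interval n (int j) (int i)"
  shows "\<exists>s. offset n i j \<le> s \<and> s < n \<and> p = (i + 1 + s) mod n"
proof -
  obtain c b' where p: "p = nat (c mod int n)" and b': "[b' = int i] (mod int n)"
    "int j \<le> b'" "b' < int j + int n" and c: "int j \<le> c" "c \<le> b'"
    using assms(3) by (auto simp: cyc_interval_def)
  have b'_eq: "b' = (if i < j then int i + int n else int i)"
    using b' assms(1,2)
    by (intro cong_int_window_unique[of _ _ "int n" "int j"]) (auto simp: cong_def)
  \<comment> \<open>If \<open>j \<le> i\<close>, the integers from \<open>j\<close> to
    \<open>i\<close> lie before the starting point \<open>i + 1\<close> and are first moved up by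
    one turn.\<close>
  define s where "s = nat (if i < j then c - int i - 1 else c + int n - int i - 1)"
  have s: "offset n i j \<le> s" "s < n"
    using c b'_eq assms(1,2) by (auto simp: s_def offset_def split: if_splits)
  have "int (i + 1 + s) = (if i < j then c else c + int n)"
    using c assms(1,2) by (auto simp: s_def)
  then have "int (i + 1 + s) mod int n = c mod int n" by simp
  then have "p = (i + 1 + s) mod n" using p by (metis nat_int of_nat_mod)
  then show ?thesis using s by blast
qed

section \<open>Monotone words read from the cut\<close>

lemma Mon_between:
  assumes "x \<in> Mon n" "r \<le> s" "s \<le> t" "t < n" "x r = x t"
  shows "x s = x r"
proof -
  have "{r, s, t} \<subseteq> {..<n}" using assms by auto
  moreover have "mono_on {..<n} x \<or> antimono_on {..<n} x" using assms(1) by (simp add: Mon_def)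
  ultimately have "x r \<le> x s \<and> x s \<le> x t \<or> x r \<ge> x s \<and> x s \<ge> x t"
    using assms(2,3) by (fastforce simp: monotone_on_def)
  then show ?thesis using assms(5) by auto
qed

text \<open>
  The equivalence negates the comparison with \<open>v\<close> once the reading, which starts at \<open>i + 1\<close>,
  has passed the end of the word.
\<close>

definition twisted :: "nat \<Rightarrow> nat \<Rightarrow> nat \<Rightarrow> (nat \<Rightarrow> nat) \<Rightarrow> nat \<Rightarrow> bool" where
  "twisted n i v x s \<longleftrightarrow> (x ((i + 1 + s) mod n) = v \<longleftrightarrow> i + 1 + s < n)"

lemma twisted_simps:
  assumes "i < n" "s < n"
  shows "i + 1 + s < n \<Longrightarrow> twisted n i v x s \<longleftrightarrow> x (i + 1 + s) = v"
    and "\<not> i + 1 + s < n \<Longrightarrow> twisted n i v x s \<longleftrightarrow> x (i + 1 + s - n) \<noteq> v"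
proof -
  show "i + 1 + s < n \<Longrightarrow> twisted n i v x s \<longleftrightarrow> x (i + 1 + s) = v"
    by (simp add: twisted_def)
  assume "\<not> i + 1 + s < n"
  moreover from this have "(i + 1 + s) mod n = i + 1 + s - n"
    using assms by (simp add: mod_if)
  ultimately show "twisted n i v x s \<longleftrightarrow> x (i + 1 + s - n) \<noteq> v"
    by (simp add: twisted_def)
qed

lemma Mon_bit: "x \<in> Mon n \<Longrightarrow> p < n \<Longrightarrow> x p = 0 \<or> x p = 1"
  by (auto simp: Mon_def dest!: PiE_mem)

text \<open>Letters are bits, so comparisons with \<open>v\<close> agree exactly when the letters
  do.\<close>

lemma Mon_between_eq:
  assumes "x \<in> Mon n" "v \<in> {0, 1}" "p \<le> q" "q \<le> r" "r < n" "(x p = v) = (x r = v)"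
  shows "(x q = v) = (x p = v)"
  using Mon_between[OF assms(1,3,4,5)] Mon_bit[OF assms(1), of p] Mon_bit[OF assms(1), of r]
    Mon_bit[OF assms(1), of q] assms by auto

lemma twisted_between:
  assumes "x \<in> Mon n" "v \<in> {0, 1}" "i < n" "r \<le> s" "s \<le> t" "t < n"
    and "twisted n i v x r = twisted n i v x t"
  shows "twisted n i v x s = twisted n i v x r"
proof -
  note B = Mon_between_eq[OF assms(1,2)]
  have T: "twisted n i v x m \<longleftrightarrow>
      (if i + 1 + m < n then x (i + 1 + m) = v else x (i + 1 + m - n) \<noteq> v)" if "m \<le> t" for m
    using twisted_simps[OF assms(3), of m] that assms(6) by auto
  consider "i + 1 + t < n" | "i + 1 + s < n" "\<not> i + 1 + t < n"
    | "i + 1 + r < n" "\<not> i + 1 + s < n" | "\<not> i + 1 + r < n" by linarith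
  then show ?thesis
  proof cases
    case 1
    moreover from 1 have "i + 1 + s < n" "i + 1 + r < n" using assms(4,5) by linarith+
    ultimately show ?thesis using B[of "i + 1 + r" "i + 1 + s" "i + 1 + t"]
        T[of r] T[of s] T[of t] assms(4,5,7)
      by simp
  next
    \<comment> \<open>Only \<open>t\<close> has wrapped, to a position before that of
      \<open>r\<close>. As its comparison is negated, the letters at \<open>r\<close> and
      \<open>t\<close> differ; a letter at \<open>s\<close> different from that at \<open>r\<close>
      would equal that at \<open>t\<close>, although \<open>r\<close> lies between them. Case 3 is
      similar, with \<open>t\<close> in the middle.\<close>
    case 2
    moreover from 2 have "i + 1 + r < n" "i + 1 + t - n \<le> i + 1 + r"
      using assms(4,6) by linarith+
    ultimately show ?thesis
      using B[of "i + 1 + t - n" "i + 1 + r" "i + 1 + s"]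
        T[of r] T[of s] T[of t] assms(4,5,7)
      by (simp del: One_nat_def) blast
  next
    case 3
    moreover from 3 have "\<not> i + 1 + t < n" "i + 1 + t - n \<le> i + 1 + r"
      "i + 1 + s - n \<le> i + 1 + t - n"
      using assms(5,6) by linarith+
    ultimately show ?thesis
      using B[of "i + 1 + s - n" "i + 1 + t - n" "i + 1 + r"]
        T[of r] T[of s] T[of t] assms(4,5,7)
      by (simp del: One_nat_def) blast
  next
    case 4
    moreover from 4 have "\<not> i + 1 + t < n" "\<not> i + 1 + s < n" "i + 1 + t - n < n"
      "i + 1 + s - n \<le> i + 1 + t - n" "i + 1 + r - n \<le> i + 1 + s - n"
      using assms(3-6) by linarith+
    ultimately show ?thesis
      using B[of "i + 1 + r - n" "i + 1 + s - n" "i + 1 + t - n"]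
        T[of r] T[of s] T[of t] assms(4,5,7)
      by simp
  qed
qed

lemma Mon_twisted_constant:
  assumes "i < n" "v \<in> {0, 1}"
  shows "\<exists>x \<in> Mon n. \<forall>s<n. twisted n i v x s"
proof
  \<comment> \<open>Positions up to \<open>i\<close> are read after the wrap, where the comparison
    is negated, so they carry the other bit.\<close>
  let ?x = "\<lambda>p\<in>{..<n}. if p \<le> i then 1 - v else v"
  show "?x \<in> Mon n" using assms(2) by (auto simp: Mon_def monotone_on_def split: if_splits)
  show "\<forall>s<n. twisted n i v ?x s"
  proof (intro allI impI)
    fix s assume "s < n"
    then show "twisted n i v ?x s"
      using twisted_simps[OF assms(1) \<open>s < n\<close>, of v ?x] assms by (cases "i + 1 + s < n") auto
  qed
qed

section \<open>The partial input\<close>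

theorem theorem5p2:
  fixes n :: nat and B :: "'b set" and J :: "'j set"
    and f :: "('j \<Rightarrow> 'b) \<Rightarrow> nat \<Rightarrow> nat"
    and i j v :: nat
  assumes "n \<ge> 1" and "finite B" and "finite J"
    and "f \<in> (J \<rightarrow>\<^sub>E B) \<rightarrow> ({..<n} \<rightarrow>\<^sub>E {0, 1})"
    and "f ` (J \<rightarrow>\<^sub>E B) = Mon n"
    and "i < n" and "j < n" and "v \<in> {0, 1}"
  shows "\<exists>\<alpha>. partial_input B J \<alpha> \<and>
      dom \<alpha> = common_window B J f (cyc_interval n (int i + 1) (int j))
            \<union> common_window B J f (cyc_interval n (int j) (int i)) \<and>
      (\<forall>x \<in> J \<rightarrow>\<^sub>E B. extends_input x \<alpha> \<longrightarrow> f x j = v)"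
proof -
  define D where "D = common_window B J f (cyc_interval n (int i + 1) (int j))
            \<union> common_window B J f (cyc_interval n (int j) (int i))"
  have DJ: "D \<subseteq> J" by (auto simp: D_def common_window_def)
  define d where "d = offset n i j"
  have d: "d < n" "(i + 1 + d) mod n = j"
    using offset_less offset_mod assms by (auto simp: d_def)
  \<comment> \<open>Position \<open>j\<close> is read after the wrap iff \<open>j \<le> i\<close>;
    this choice makes a true twisted letter at \<open>d\<close> mean \<open>f x j = v\<close> in
    both cases.\<close>
  define c where "c = (if i < j then v else 1 - v)"
  have c: "c \<in> {0, 1}" using assms(8) by (auto simp: c_def)
  let ?Y = "\<lambda>x. twisted n i c (f x)"
  obtain w where w: "w \<in> Mon n" "\<forall>s<n. twisted n i c w s"
    using Mon_twisted_constant[OF assms(6) c] by blast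
  from w(1) obtain u where u: "u \<in> J \<rightarrow>\<^sub>E B" and fu: "f u = w"
    unfolding assms(5)[symmetric] by blast
  have in_Mon: "f x \<in> Mon n" if "x \<in> J \<rightarrow>\<^sub>E B" for x
    using that unfolding assms(5)[symmetric] by (rule imageI)
  have ignored: "?Y x s = ?Y y s"
    if "k \<notin> input_window B J f ((i + 1 + s) mod n)" "x \<in> J \<rightarrow>\<^sub>E B" "y \<in> J \<rightarrow>\<^sub>E B"
      "\<And>l. l \<noteq> k \<Longrightarrow> x l = y l" for k s x y
  proof -
    have "\<forall>l \<in> input_window B J f ((i + 1 + s) mod n). x l = y l"
      using that(1,4) by metis
    then have "f x ((i + 1 + s) mod n) = f y ((i + 1 + s) mod n)"
      using input_window_least(1)[OF assms(3), of B f "(i + 1 + s) mod n"] that(2,3) by blast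
    then show ?thesis by (simp add: twisted_def)
  qed
  \<comment> \<open>Being outside both common windows, \<open>k\<close> is missed by some window in
    each interval; these outputs have offsets on either side of \<open>d\<close>.\<close>
  have "\<exists>a b. a \<le> d \<and> d \<le> b \<and> b < n \<and> k \<notin> input_window B J f ((i + 1 + a) mod n)
      \<and> k \<notin> input_window B J f ((i + 1 + b) mod n)" if k: "k \<in> J - D" for k
  proof -
    obtain p where p: "p \<in> cyc_interval n (int i + 1) (int j)" "k \<notin> input_window B J f p"
      using k unfolding D_def common_window_def by blast
    obtain q where q: "q \<in> cyc_interval n (int j) (int i)" "k \<notin> input_window B J f q"
      using k unfolding D_def common_window_def by blast
    show ?thesis
      using cyc_interval_left[OF assms(6,7) p(1)] cyc_interval_right[OF assms(6,7) q(1)] p(2) q(2)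
      unfolding d_def by blast
  qed
  then obtain a b where ab: "\<And>k. k \<in> J - D \<Longrightarrow> a k \<le> d \<and> d \<le> b k \<and> b k < n
      \<and> k \<notin> input_window B J f ((i + 1 + a k) mod n)
      \<and> k \<notin> input_window B J f ((i + 1 + b k) mod n)" by metis
  have forced: "f x j = v" if x: "x \<in> J \<rightarrow>\<^sub>E B" "\<And>k. k \<in> D \<Longrightarrow> x k = u k" for x
  proof -
    \<comment> \<open>This interpolates from \<open>u\<close> at \<open>{}\<close> to
      \<open>x\<close> at \<open>J - D\<close>.\<close>
    define z where "z = (\<lambda>S k. if k \<in> S then x k else u k)"
    have z: "z S \<in> J \<rightarrow>\<^sub>E B" for S
      using x(1) u by (auto simp: z_def PiE_iff extensional_def)
    have step: "z (S - {k}) l = z S l" if "l \<noteq> k" for S k l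
      using that by (simp add: z_def)
    have "?Y (z (J - D)) d"
    proof (rule letter_unchanged[of "J - D" n "\<lambda>S. ?Y (z S)" a d b])
      show "?Y (z S) s = ?Y (z S) r"
        if "r \<le> s" "s \<le> t" "t < n" "?Y (z S) r = ?Y (z S) t" for S r s t
        using twisted_between[OF in_Mon[OF z] c assms(6)] that by blast
      show "?Y (z (S - {k})) (a k) = ?Y (z S) (a k)" if "S \<subseteq> J - D" "k \<in> S" for S k
        using ab[of k] that by (intro ignored[OF _ z z step]) auto
      show "?Y (z (S - {k})) (b k) = ?Y (z S) (b k)" if "S \<subseteq> J - D" "k \<in> S" for S k
        using ab[of k] that by (intro ignored[OF _ z z step]) auto
      show "?Y (z {}) s" if "s < n" for s
        using w(2) that fu by (simp add: z_def)
    qed (use assms(3) ab d in auto)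
    moreover have "z (J - D) = x"
    proof
      fix k show "z (J - D) k = x k"
        using x u PiE_arb[of x J "\<lambda>_. B" k] PiE_arb[of u J "\<lambda>_. B" k] by (auto simp: z_def)
    qed
    ultimately have "?Y x d" by simp
    moreover have "i + 1 + d < n \<longleftrightarrow> i < j"
      using assms(6,7) by (auto simp: d_def offset_def)
    moreover have "f x j = 0 \<or> f x j = 1"
      by (rule Mon_bit[OF in_Mon[OF x(1)] assms(7)])
    ultimately show ?thesis
      using assms(8) d(2) by (auto simp: twisted_def c_def split: if_splits)
  qed
  define \<alpha> where "\<alpha> = (\<lambda>k. if k \<in> D then Some (u k) else None)"
  have dom: "dom \<alpha> = D" by (auto simp: \<alpha>_def dom_def)
  have "partial_input B J \<alpha>"
    using DJ dom PiE_mem[OF u] by (auto simp: partial_input_def ran_def \<alpha>_def)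
  moreover have "f x j = v" if "x \<in> J \<rightarrow>\<^sub>E B" "extends_input x \<alpha>" for x
    using that dom by (intro forced) (auto simp: extends_input_def \<alpha>_def)
  ultimately show ?thesis using dom unfolding D_def by blast
qed

end
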